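(* Let $T$ be a locally finite tree, equipped with its geodesic metric in which all edges have length $1$. There exists a uniform embedding $f$ of $T$ into a Hilbert space $\mathcal{H}$ with $$\rho_f(t)\succeq \frac{t}{\sqrt{\ln t}\cdot \ln\ln t}.$$
   Context: Let $(X,d_X)$ be a metric space and $\mathcal{H}$ a Hilbert space, with $d_{\mathcal{H}}$ the metric given by the norm. A map $f\colon X\to\mathcal{H}$ is a uniform embedding if there exist non-decreasing functions $\rho,\delta\colon\mathbb{R}_+\to\mathbb{R}_+$ such that (1) $\rho(d_X(x,y))\le d_{\mathcal{H}}(f(x),f(y))\le\delta(d_X(x,y))$ for all $x,y\in X$, and (2) $\lim_{t\to+\infty}\rho(t)=+\infty$. The compression of $f$ is the function $\rho_f(t)=\inf\{d_{\mathcal{H}}(f(x),f(y)) \mid d_X(x,y)\ge t\}$ (with $\inf\emptyset=+\infty$). For functions $g,h$ of a positive real variable (defined for all sufficiently large $t$), $g\preceq h$ (equivalently $h\succeq g$) means that there exist numbers $C>0$ and $M$ such that $g(t)\le C\,h(t)$ for all $t\ge M$. *)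

theory Defs
  imports "HOL-Analysis.Analysis"
begin

section \<open>Trees\<close>

text \<open>A simple undirected graph is a vertex set with a symmetric, irreflexive adjacency relation.\<close>

definition simple_graph :: "'v set \<Rightarrow> 'v rel \<Rightarrow> bool" where
  "simple_graph V E \<longleftrightarrow> E \<subseteq> V \<times> V \<and> sym E \<and> irrefl E"

definition connected_graph :: "'v set \<Rightarrow> 'v rel \<Rightarrow> bool" where
  "connected_graph V E \<longleftrightarrow> V \<noteq> {} \<and> (\<forall>u\<in>V. \<forall>v\<in>V. (u, v) \<in> E\<^sup>*)"

definition graph_cycle :: "'v rel \<Rightarrow> 'v list \<Rightarrow> bool" where
  "graph_cycle E c \<longleftrightarrow> 3 \<le> length c \<and> distinct c \<and>
     successively (\<lambda>u v. (u, v) \<in> E) c \<and> (last c, hd c) \<in> E"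

definition graph_tree :: "'v set \<Rightarrow> 'v rel \<Rightarrow> bool" where
  "graph_tree V E \<longleftrightarrow> simple_graph V E \<and> connected_graph V E \<and> (\<nexists>c. graph_cycle E c)"

definition locally_finite_graph :: "'v set \<Rightarrow> 'v rel \<Rightarrow> bool" where
  "locally_finite_graph V E \<longleftrightarrow> (\<forall>v\<in>V. finite {w. (v, w) \<in> E})"


section \<open>The geometric realization and its geodesic metric\<close>

text \<open>
  Points of the realization are given by barycentric coordinates: a point is a nonnegative
  function on the vertices with total mass 1 that is supported on a vertex or on an edge.
\<close>

definition supp :: "('v \<Rightarrow> real) \<Rightarrow> 'v set" where
  "supp x = {v. x v \<noteq> 0}"

definition simplices :: "'v set \<Rightarrow> 'v rel \<Rightarrow> 'v set set" where
  "simplices V E = {{v} |v. v \<in> V} \<union> {{u, v} |u v. (u, v) \<in> E}"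

definition realization :: "'v set \<Rightarrow> 'v rel \<Rightarrow> ('v \<Rightarrow> real) set" where
  "realization V E =
     {x. (\<forall>v. 0 \<le> x v) \<and> supp x \<in> simplices V E \<and> (\<Sum>v\<in>supp x. x v) = 1}"

text \<open>
  On a closed edge \<open>{u, v}\<close> both coordinates contribute \<open>\<bar>x u - y u\<bar> = \<bar>x v - y v\<bar>\<close>;
  the factor 1/2 makes the edge isometric to the unit interval.
\<close>

definition edge_dist :: "('v \<Rightarrow> real) \<Rightarrow> ('v \<Rightarrow> real) \<Rightarrow> real" where
  "edge_dist x y = (\<Sum>v\<in>supp x \<union> supp y. \<bar>x v - y v\<bar>) / 2"

text \<open>A chain is a finite sequence of points in which consecutive points share a closed edge.\<close>

definition chains :: "'v set \<Rightarrow> 'v rel \<Rightarrow> ('v \<Rightarrow> real) \<Rightarrow> ('v \<Rightarrow> real) \<Rightarrow> ('v \<Rightarrow> real) list set" where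
  "chains V E x y =
     {zs. zs \<noteq> [] \<and> hd zs = x \<and> last zs = y \<and> set zs \<subseteq> realization V E \<and>
          successively (\<lambda>a b. \<exists>s\<in>simplices V E. supp a \<union> supp b \<subseteq> s) zs}"

fun chain_length :: "('v \<Rightarrow> real) list \<Rightarrow> real" where
  "chain_length (x # y # zs) = edge_dist x y + chain_length (y # zs)"
| "chain_length _ = 0"

text \<open>
  The length metric; outside the realization it takes the dummy value 0, so that it is total as
  \<^locale>\<open>Metric_space\<close> requires.
\<close>

definition geodesic_dist :: "'v set \<Rightarrow> 'v rel \<Rightarrow> ('v \<Rightarrow> real) \<Rightarrow> ('v \<Rightarrow> real) \<Rightarrow> real" where
  "geodesic_dist V E x y =
     (if x \<in> realization V E \<and> y \<in> realization V E
      then INF zs\<in>chains V E x y. chain_length zs else 0)"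

lemma edge_dist_superset:
  assumes "finite S" "supp x \<union> supp y \<subseteq> S"
  shows "edge_dist x y = (\<Sum>v\<in>S. \<bar>x v - y v\<bar>) / 2"
  unfolding edge_dist_def using assms
  by (intro arg_cong[where f = "\<lambda>t. t / 2"] sum.mono_neutral_left) (auto simp: supp_def)

lemma edge_dist_nonneg: "0 \<le> edge_dist x y"
  by (simp add: edge_dist_def sum_nonneg)

lemma edge_dist_commute: "edge_dist x y = edge_dist y x"
  by (simp add: edge_dist_def Un_commute abs_minus_commute)

lemma edge_dist_refl [simp]: "edge_dist x x = 0"
  by (simp add: edge_dist_def)

lemma finite_simplex: "s \<in> simplices V E \<Longrightarrow> finite s"
  by (auto simp: simplices_def)

lemma finite_supp: "x \<in> realization V E \<Longrightarrow> finite (supp x)"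
  by (auto simp: realization_def intro: finite_simplex)

lemma edge_dist_triangle:
  assumes "finite (supp x)" "finite (supp y)" "finite (supp z)"
  shows "edge_dist x z \<le> edge_dist x y + edge_dist y z"
proof -
  let ?S = "supp x \<union> supp y \<union> supp z"
  have "(\<Sum>v\<in>?S. \<bar>x v - z v\<bar>) \<le> (\<Sum>v\<in>?S. \<bar>x v - y v\<bar> + \<bar>y v - z v\<bar>)"
    by (intro sum_mono) linarith
  moreover have "edge_dist x z = (\<Sum>v\<in>?S. \<bar>x v - z v\<bar>) / 2"
    "edge_dist x y = (\<Sum>v\<in>?S. \<bar>x v - y v\<bar>) / 2"
    "edge_dist y z = (\<Sum>v\<in>?S. \<bar>y v - z v\<bar>) / 2"
    using assms by (blast intro: edge_dist_superset)+
  ultimately show ?thesis by (simp add: sum.distrib)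
qed

lemma edge_dist_eq_0:
  assumes "finite (supp x)" "finite (supp y)" "edge_dist x y = 0"
  shows "x = y"
proof
  fix v
  have "\<forall>v\<in>supp x \<union> supp y. \<bar>x v - y v\<bar> = 0"
    using assms by (subst sum_nonneg_eq_0_iff[symmetric]) (auto simp: edge_dist_def)
  then have "v \<in> supp x \<union> supp y \<Longrightarrow> x v = y v" by force
  moreover have "v \<notin> supp x \<union> supp y \<Longrightarrow> x v = y v" by (simp add: supp_def)
  ultimately show "x v = y v" by blast
qed

lemma chain_length_nonneg: "0 \<le> chain_length zs"
  by (induction zs rule: chain_length.induct) (auto intro: add_nonneg_nonneg edge_dist_nonneg)

lemma chain_length_append:
  assumes "xs \<noteq> []" "ys \<noteq> []"
  shows "chain_length (xs @ ys) = chain_length xs + edge_dist (last xs) (hd ys) + chain_length ys"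
  using assms
proof (induction xs rule: chain_length.induct)
  case ("2_2" v)
  then show ?case by (cases ys) auto
qed auto

lemma chain_length_rev: "chain_length (rev zs) = chain_length zs"
proof (induction zs)
  case (Cons a zs)
  show ?case
  proof (cases "zs = []")
    case False
    then have "chain_length (rev zs @ [a]) = chain_length (rev zs) + edge_dist (hd zs) a"
      by (simp add: chain_length_append last_rev)
    moreover have "chain_length (a # zs) = edge_dist a (hd zs) + chain_length zs"
      using False by (cases zs) auto
    ultimately show ?thesis using Cons by (simp add: edge_dist_commute)
  qed auto
qed auto

lemma chains_rev:
  assumes "zs \<in> chains V E x y"
  shows "rev zs \<in> chains V E y x"
proof -
  have "successively (\<lambda>a b. \<exists>s\<in>simplices V E. supp b \<union> supp a \<subseteq> s) zs"
    using assms by (simp add: chains_def Un_commute)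
  then show ?thesis
    using assms by (simp add: chains_def hd_rev last_rev)
qed

lemma chains_append:
  assumes "xs \<in> chains V E x y" "ys \<in> chains V E y z"
  shows "xs @ ys \<in> chains V E x z" "chain_length (xs @ ys) = chain_length xs + chain_length ys"
proof -
  have "y \<in> realization V E"
    using assms(2) list.set_sel(1)[of ys] by (auto simp: chains_def)
  then have "\<exists>s\<in>simplices V E. supp y \<union> supp y \<subseteq> s"
    by (auto simp: realization_def)
  then show "xs @ ys \<in> chains V E x z"
    using assms by (auto simp: chains_def successively_append_iff)
  show "chain_length (xs @ ys) = chain_length xs + chain_length ys"
    using assms by (subst chain_length_append) (auto simp: chains_def)
qed

lemma edge_dist_le_chain_length:
  assumes "zs \<noteq> []" "set zs \<subseteq> realization V E"
  shows "edge_dist (hd zs) (last zs) \<le> chain_length zs"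
  using assms
proof (induction zs rule: chain_length.induct)
  case (1 x y zs)
  have "last (y # zs) \<in> realization V E"
    using 1(3) by (metis last_in_set list.discI set_subset_Cons subset_iff)
  then have "edge_dist x (last (y # zs)) \<le> edge_dist x y + edge_dist y (last (y # zs))"
    using 1(3) by (intro edge_dist_triangle finite_supp[of _ V E]) auto
  then show ?case using 1 by auto
qed auto

lemma bdd_below_chain_length: "bdd_below (chain_length ` A)"
  by (rule bdd_belowI2[of _ 0]) (rule chain_length_nonneg)

definition vertex_point :: "'v \<Rightarrow> 'v \<Rightarrow> real" where
  "vertex_point u = (\<lambda>v. if v = u then 1 else 0)"

lemma supp_vertex_point [simp]: "supp (vertex_point u) = {u}"
  by (auto simp: supp_def vertex_point_def)

lemma vertex_point_in_realization: "u \<in> V \<Longrightarrow> vertex_point u \<in> realization V E"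
  by (auto simp: realization_def simplices_def vertex_point_def[of u] supp_def)

lemma edge_dist_edge: "u \<noteq> v \<Longrightarrow> edge_dist (vertex_point u) (vertex_point v) = 1"
  by (simp add: edge_dist_def) (simp add: vertex_point_def)

lemma chain_of_walk:
  assumes "simple_graph V E" "u \<in> V" "(u, v) \<in> E ^^ n"
  shows "\<exists>zs \<in> chains V E (vertex_point u) (vertex_point v). chain_length zs = real n"
  using assms(3)
proof (induction n arbitrary: v)
  case 0
  then show ?case using assms
    by (intro bexI[of _ "[vertex_point u]"]) (auto simp: chains_def vertex_point_in_realization)
next
  case (Suc n)
  then obtain w where w: "(u, w) \<in> E ^^ n" "(w, v) \<in> E" by auto
  then obtain zs where zs: "zs \<in> chains V E (vertex_point u) (vertex_point w)"
    "chain_length zs = real n" using Suc by blast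
  have wv: "w \<noteq> v" "v \<in> V" using w assms by (auto simp: simple_graph_def irrefl_def)
  have "\<exists>s\<in>simplices V E. {w} \<union> {v} \<subseteq> s" using w(2) by (auto simp: simplices_def)
  then have "zs @ [vertex_point v] \<in> chains V E (vertex_point u) (vertex_point v)"
    using zs wv by (auto simp: chains_def successively_append_iff vertex_point_in_realization)
  moreover have "chain_length (zs @ [vertex_point v]) = real (Suc n)"
    using zs wv by (subst chain_length_append) (auto simp: chains_def edge_dist_edge)
  ultimately show ?case by blast
qed

lemma chains_nonempty:
  assumes "simple_graph V E" "connected_graph V E" "x \<in> realization V E" "y \<in> realization V E"
  shows "chains V E x y \<noteq> {}"
proof -
  have near: "\<exists>u\<in>V. u \<in> supp x \<and> [x, vertex_point u] \<in> chains V E x (vertex_point u)"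
    if x: "x \<in> realization V E" for x
  proof -
    have s: "supp x \<in> simplices V E" using x by (simp add: realization_def)
    then obtain u where u: "u \<in> supp x" by (auto simp: simplices_def)
    have "u \<in> V" using s u assms(1) by (auto simp: simplices_def simple_graph_def)
    moreover have "[x, vertex_point u] \<in> chains V E x (vertex_point u)"
      using x s u \<open>u \<in> V\<close> by (auto simp: chains_def vertex_point_in_realization)
    ultimately show ?thesis using u by blast
  qed
  obtain u v where uv: "u \<in> V" "v \<in> V" "[x, vertex_point u] \<in> chains V E x (vertex_point u)"
    "[y, vertex_point v] \<in> chains V E y (vertex_point v)"
    using near assms(3,4) by meson
  obtain n where "(u, v) \<in> E ^^ n"
    using assms(2) uv(1,2) rtrancl_imp_relpow[of "(u, v)" E]
    unfolding connected_graph_def by blast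
  from chain_of_walk[OF assms(1) uv(1) this]
  obtain zs where "zs \<in> chains V E (vertex_point u) (vertex_point v)" by blast
  from chains_append(1)[OF chains_append(1)[OF uv(3) this] chains_rev[OF uv(4)]]
  show ?thesis by blast
qed

lemma geodesic_dist_le:
  "zs \<in> chains V E x y \<Longrightarrow> geodesic_dist V E x y \<le> chain_length zs"
  using cINF_lower[OF bdd_below_chain_length, of zs "chains V E x y"] chain_length_nonneg[of zs]
  by (simp add: geodesic_dist_def)

lemma geodesic_dist_ge:
  assumes "simple_graph V E" "connected_graph V E" "x \<in> realization V E" "y \<in> realization V E"
    and "\<And>zs. zs \<in> chains V E x y \<Longrightarrow> c \<le> chain_length zs"
  shows "c \<le> geodesic_dist V E x y"
  using cINF_greatest[OF chains_nonempty[OF assms(1-4)], of c chain_length] assms(3-5)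
  by (simp add: geodesic_dist_def)

theorem Metric_space_realization:
  assumes "simple_graph V E" "connected_graph V E"
  shows "Metric_space (realization V E) (geodesic_dist V E)"
proof
  note ne = chains_nonempty[OF assms]
  note ge = geodesic_dist_ge[OF assms]
  fix x y z
  show "0 \<le> geodesic_dist V E x y"
    using ge[of x y 0] chain_length_nonneg by (cases "x \<in> realization V E \<and> y \<in> realization V E")
      (auto simp: geodesic_dist_def)
  have "geodesic_dist V E x y \<le> geodesic_dist V E y x"
    if "x \<in> realization V E" "y \<in> realization V E" for x y
  proof (rule ge)
    fix zs assume "zs \<in> chains V E y x"
    then show "geodesic_dist V E x y \<le> chain_length zs"
      using geodesic_dist_le[OF chains_rev] chain_length_rev by metis
  qed (use that in auto)
  then show "geodesic_dist V E x y = geodesic_dist V E y x"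
    by (cases "x \<in> realization V E \<and> y \<in> realization V E")
      (auto simp: geodesic_dist_def intro!: antisym)
  assume x: "x \<in> realization V E" and y: "y \<in> realization V E"
  have lower: "edge_dist x y \<le> geodesic_dist V E x y"
    using x y by (intro ge) (auto simp: chains_def dest: edge_dist_le_chain_length)
  have "geodesic_dist V E x x \<le> 0" 
    using x geodesic_dist_le[of "[x]" V E x x] by (auto simp: chains_def)
  then show "geodesic_dist V E x y = 0 \<longleftrightarrow> x = y"
    using lower edge_dist_nonneg[of x y] edge_dist_eq_0[of x y] finite_supp x y
      ge[of x x 0] chain_length_nonneg by (metis antisym)
  assume z: "z \<in> realization V E"
  have *: "geodesic_dist V E x z \<le> chain_length xs + chain_length ys"
    if "xs \<in> chains V E x y" "ys \<in> chains V E y z" for xs ys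
    using geodesic_dist_le[OF chains_append(1)[OF that]] chains_append(2)[OF that] by simp
  have "geodesic_dist V E x z - geodesic_dist V E x y \<le> chain_length ys"
    if "ys \<in> chains V E y z" for ys
  proof -
    have "geodesic_dist V E x z - chain_length ys \<le> geodesic_dist V E x y"
      using *[OF _ that] by (intro ge x y) (simp add: diff_le_eq)
    then show ?thesis by linarith
  qed
  then have "geodesic_dist V E x z - geodesic_dist V E x y \<le> geodesic_dist V E y z"
    by (intro ge y z)
  then show "geodesic_dist V E x z \<le> geodesic_dist V E x y + geodesic_dist V E y z" by simp
qed

text \<open>Between vertices the metric is the number of edges of a shortest walk.\<close>

theorem geodesic_dist_vertex_point:
  assumes "simple_graph V E" "connected_graph V E" "u \<in> V" "v \<in> V"
  shows "geodesic_dist V E (vertex_point u) (vertex_point v) = real (LEAST n. (u, v) \<in> E ^^ n)"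
proof -
  define d where "d w = (LEAST n. (u, w) \<in> E ^^ n)" for w
  have d: "(u, w) \<in> E ^^ d w" if "w \<in> V" for w
  proof -
    have "(u, w) \<in> E\<^sup>*"
      using assms(2,3) that unfolding connected_graph_def by blast
    then obtain n where "(u, w) \<in> E ^^ n"
      using rtrancl_imp_relpow by blast
    then show ?thesis unfolding d_def by (rule LeastI)
  qed
  have d_step: "d w' \<le> Suc (d w)" if "(w, w') \<in> E" for w w'
    unfolding d_def[of w'] using that d[of w] assms(1)
    by (intro Least_le) (auto simp: simple_graph_def)
  have d_edge: "\<bar>real (d w) - real (d w')\<bar> \<le> 1" if "(w, w') \<in> E" for w w'
  proof -
    have "(w', w) \<in> E" using that assms(1) by (auto simp: simple_graph_def sym_def)
    then show ?thesis using d_step[OF that] d_step[of w' w] by linarith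
  qed
  \<comment> \<open>The affine extension of the distance from \<open>u\<close> is 1-Lipschitz.\<close>
  define D where "D x = (\<Sum>w\<in>supp x. x w * real (d w))" for x
  have D_sup: "D x = (\<Sum>w\<in>S. x w * real (d w))" "(\<Sum>w\<in>supp x. x w) = sum x S"
    if "finite S" "supp x \<subseteq> S" for x S
    unfolding D_def using that by (auto simp: supp_def intro!: sum.mono_neutral_left)
  have lip: "\<bar>D x - D y\<bar> \<le> edge_dist x y"
    if xy: "x \<in> realization V E" "y \<in> realization V E"
      and s: "s \<in> simplices V E" "supp x \<union> supp y \<subseteq> s" for x y s
  proof -
    have fin: "finite s" using s finite_simplex by blast
    have 1: "sum x s = 1" "sum y s = 1"
      using xy D_sup(2)[OF fin] s by (auto simp: realization_def)
    have ed: "edge_dist x y = (\<Sum>v\<in>s. \<bar>x v - y v\<bar>) / 2"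
      using edge_dist_superset fin s by blast
    have Dx: "D x = (\<Sum>w\<in>s. x w * real (d w))" "D y = (\<Sum>w\<in>s. y w * real (d w))"
      using D_sup(1)[OF fin] s by auto
    from s(1) consider a where "s = {a}" | a b where "s = {a, b}" "(a, b) \<in> E" "a \<noteq> b"
      using assms(1) by (auto simp: simplices_def simple_graph_def irrefl_def)
    then show ?thesis
    proof cases
      case 1
      then show ?thesis using \<open>sum x s = 1\<close> \<open>sum y s = 1\<close> ed Dx by simp
    next
      case 2
      have e: "x b = 1 - x a" "y b = 1 - y a" using 1 2 by auto
      have "D x - D y = (x a - y a) * (real (d a) - real (d b))"
        using Dx 2 by (simp add: e algebra_simps)
      then have "\<bar>D x - D y\<bar> \<le> \<bar>x a - y a\<bar> * 1"
        using d_edge[OF 2(2)] by (simp add: abs_mult mult_left_le)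
      also have "\<dots> = edge_dist x y" using ed 2 by (simp add: e)
      finally show ?thesis .
    qed
  qed
  have chain: "\<bar>D (hd zs) - D (last zs)\<bar> \<le> chain_length zs"
    if "zs \<noteq> []" "set zs \<subseteq> realization V E"
      "successively (\<lambda>a b. \<exists>s\<in>simplices V E. supp a \<union> supp b \<subseteq> s) zs" for zs
    using that
  proof (induction zs rule: chain_length.induct)
    case (1 x y zs)
    then obtain s where "s \<in> simplices V E" "supp x \<union> supp y \<subseteq> s" by auto
    then have "\<bar>D x - D y\<bar> \<le> edge_dist x y" using 1(3) by (intro lip) auto
    then show ?case using 1 by auto
  qed auto
  have "d u = 0" unfolding d_def by (simp add: Least_eq_0)
  then have Duv: "D (vertex_point u) = 0" "D (vertex_point v) = d v"
    unfolding D_def supp_vertex_point by (simp_all add: vertex_point_def)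
  have "real (d v) \<le> geodesic_dist V E (vertex_point u) (vertex_point v)"
  proof (rule geodesic_dist_ge[OF assms(1,2)])
    fix zs assume "zs \<in> chains V E (vertex_point u) (vertex_point v)"
    then show "real (d v) \<le> chain_length zs"
      using chain[of zs] Duv by (auto simp: chains_def)
  qed (intro vertex_point_in_realization assms)+
  moreover have "geodesic_dist V E (vertex_point u) (vertex_point v) \<le> real (d v)"
    using chain_of_walk[OF assms(1,3) d[OF assms(4)]] geodesic_dist_le by metis
  ultimately show ?thesis by (simp add: d_def)
qed


section \<open>The Hilbert space of square-summable sequences\<close>

typedef ell2 = "{x :: nat \<Rightarrow> real. summable (\<lambda>n. (x n)\<^sup>2)}"
  morphisms coord Abs_ell2
  by (rule exI[of _ "\<lambda>_. 0"]) simp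

setup_lifting type_definition_ell2

lemma ell2_summable_mult:
  fixes x y :: "nat \<Rightarrow> real"
  assumes "summable (\<lambda>n. (x n)\<^sup>2)" "summable (\<lambda>n. (y n)\<^sup>2)"
  shows "summable (\<lambda>n. x n * y n)"
proof (rule summable_comparison_test)
  show "summable (\<lambda>n. (x n)\<^sup>2 + (y n)\<^sup>2)" using assms by (rule summable_add)
  have "\<bar>x n * y n\<bar> \<le> (x n)\<^sup>2 + (y n)\<^sup>2" for n
    using sum_squares_bound[of "\<bar>x n\<bar>" "\<bar>y n\<bar>"] abs_ge_zero[of "x n * y n"]
    unfolding abs_mult power2_abs by linarith
  then show "\<exists>N. \<forall>n\<ge>N. norm (x n * y n) \<le> (x n)\<^sup>2 + (y n)\<^sup>2" by auto
qed

lemma ell2_summable_add: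
  fixes x y :: "nat \<Rightarrow> real"
  assumes "summable (\<lambda>n. (x n)\<^sup>2)" "summable (\<lambda>n. (y n)\<^sup>2)"
  shows "summable (\<lambda>n. (x n + y n)\<^sup>2)"
  using summable_add[OF summable_add[OF assms] summable_mult[OF ell2_summable_mult[OF assms], of 2]]
  by (simp add: power2_sum mult.assoc)

instantiation ell2 :: real_inner
begin

lift_definition zero_ell2 :: ell2 is "\<lambda>_. 0" by simp

lift_definition plus_ell2 :: "ell2 \<Rightarrow> ell2 \<Rightarrow> ell2" is "\<lambda>x y n. x n + y n"
  by (rule ell2_summable_add)

lift_definition uminus_ell2 :: "ell2 \<Rightarrow> ell2" is "\<lambda>x n. - x n" by simp

lift_definition minus_ell2 :: "ell2 \<Rightarrow> ell2 \<Rightarrow> ell2" is "\<lambda>x y n. x n - y n"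
  subgoal for x y using ell2_summable_add[of x "\<lambda>n. - y n"] by simp
  done

lift_definition scaleR_ell2 :: "real \<Rightarrow> ell2 \<Rightarrow> ell2" is "\<lambda>r x n. r * x n"
  by (simp add: power_mult_distrib summable_mult)

lift_definition inner_ell2 :: "ell2 \<Rightarrow> ell2 \<Rightarrow> real" is "\<lambda>x y. \<Sum>n. x n * y n" .

definition norm_ell2 :: "ell2 \<Rightarrow> real" where "norm_ell2 x = sqrt (inner x x)"

definition sgn_ell2 :: "ell2 \<Rightarrow> ell2" where "sgn_ell2 x = scaleR (inverse (norm x)) x"

definition dist_ell2 :: "ell2 \<Rightarrow> ell2 \<Rightarrow> real" where "dist_ell2 x y = norm (x - y)"

definition uniformity_ell2 :: "(ell2 \<times> ell2) filter" where
  "uniformity_ell2 = (INF e\<in>{0 <..}. principal {(x, y). dist x y < e})"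

definition open_ell2 :: "ell2 set \<Rightarrow> bool" where
  "open_ell2 S = (\<forall>x\<in>S. \<forall>\<^sub>F (x', y) in uniformity. x' = x \<longrightarrow> y \<in> S)"

instance
proof
  fix x y z :: ell2 and r s :: real
  show "x + y + z = x + (y + z)" "x + y = y + x" "0 + x = x" "- x + x = 0" "x - y = x + - y"
    "r *\<^sub>R (x + y) = r *\<^sub>R x + r *\<^sub>R y" "(r + s) *\<^sub>R x = r *\<^sub>R x + s *\<^sub>R x"
    "r *\<^sub>R s *\<^sub>R x = (r * s) *\<^sub>R x" "1 *\<^sub>R x = x"
    by (transfer; simp add: algebra_simps)+
  show "sgn x = scaleR (inverse (norm x)) x" "dist x y = norm (x - y)"
    "(uniformity :: (ell2 \<times> ell2) filter) = (INF e\<in>{0 <..}. principal {(x, y). dist x y < e})"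
    "norm x = sqrt (inner x x)"
    by (simp_all add: sgn_ell2_def dist_ell2_def uniformity_ell2_def norm_ell2_def)
  show "open S = (\<forall>x\<in>S. \<forall>\<^sub>F (x', y) in uniformity. x' = x \<longrightarrow> y \<in> S)" for S :: "ell2 set"
    by (simp add: open_ell2_def)
  show "inner x y = inner y x" by transfer (simp add: mult.commute)
  show "inner (x + y) z = inner x z + inner y z"
    by transfer (simp add: distrib_right suminf_add ell2_summable_mult)
  show "inner (r *\<^sub>R x) y = r * inner x y"
    by transfer (simp add: mult.assoc suminf_mult ell2_summable_mult)
  show "0 \<le> inner x x"
    by transfer (simp add: suminf_nonneg power2_eq_square)
  show "inner x x = 0 \<longleftrightarrow> x = 0"
    by transfer (simp add: suminf_eq_zero_iff power2_eq_square fun_eq_iff)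
qed

end

lemma ell2_norm_power2: "(norm x)\<^sup>2 = (\<Sum>n. (coord x n)\<^sup>2)"
  unfolding power2_norm_eq_inner by transfer (simp add: power2_eq_square)

lemma ell2_partial_norm_le: "(\<Sum>n<N. (coord x n)\<^sup>2) \<le> (norm x)\<^sup>2"
  unfolding ell2_norm_power2 using coord[of x] by (intro sum_le_suminf) auto

lemma ell2_coord_le: "\<bar>coord x n\<bar> \<le> norm x"
proof -
  have "(coord x n)\<^sup>2 \<le> (\<Sum>k<Suc n. (coord x k)\<^sup>2)" by (simp add: sum_nonneg)
  also have "\<dots> \<le> (norm x)\<^sup>2" by (rule ell2_partial_norm_le)
  finally have "\<bar>coord x n\<bar>\<^sup>2 \<le> (norm x)\<^sup>2" by simp
  then show ?thesis by (rule power2_le_imp_le) simp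
qed

lemma coord_diff: "coord (x - y) n = coord x n - coord y n"
  by transfer simp

instance ell2 :: complete_space
proof
  fix X :: "nat \<Rightarrow> ell2" assume X: "Cauchy X"
  have "Cauchy (\<lambda>m. coord (X m) n)" for n
    using X unfolding Cauchy_def dist_norm
    by (metis coord_diff ell2_coord_le order_le_less_trans real_norm_def)
  then have "\<exists>l. (\<lambda>m. coord (X m) n) \<longlonglongrightarrow> l" for n
    using Cauchy_convergent convergent_def by blast
  then obtain l where l: "\<And>n. (\<lambda>m. coord (X m) n) \<longlonglongrightarrow> l n" by metis
  have bound: "(\<Sum>n<N. (coord (X m) n - l n)\<^sup>2) \<le> e\<^sup>2"
    if "\<And>k. k \<ge> M \<Longrightarrow> dist (X m) (X k) < e" for m M N e
  proof (rule tendsto_upperbound)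
    show "(\<lambda>k. \<Sum>n<N. (coord (X m) n - coord (X k) n)\<^sup>2)
            \<longlonglongrightarrow> (\<Sum>n<N. (coord (X m) n - l n)\<^sup>2)"
      by (intro tendsto_intros l)
    have "(\<Sum>n<N. (coord (X m) n - coord (X k) n)\<^sup>2) \<le> e\<^sup>2" if "k \<ge> M" for k
    proof -
      have "(\<Sum>n<N. (coord (X m) n - coord (X k) n)\<^sup>2) \<le> (norm (X m - X k))\<^sup>2"
        using ell2_partial_norm_le[of "X m - X k"] by (simp add: coord_diff)
      also have "\<dots> \<le> e\<^sup>2"
        using \<open>\<And>k. k \<ge> M \<Longrightarrow> dist (X m) (X k) < e\<close>[OF that]
        by (intro power_mono) (auto simp: dist_norm)
      finally show ?thesis .
    qed
    then show "\<forall>\<^sub>F k in sequentially. (\<Sum>n<N. (coord (X m) n - coord (X k) n)\<^sup>2) \<le> e\<^sup>2"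
      using eventually_sequentially by blast
  qed simp
  have sq: "summable (\<lambda>n. (coord (X m) n - l n)\<^sup>2)" "(\<Sum>n. (coord (X m) n - l n)\<^sup>2) \<le> e\<^sup>2"
    if "\<And>k. k \<ge> M \<Longrightarrow> dist (X m) (X k) < e" for m M e
  proof -
    have b: "(\<Sum>n<N. (coord (X m) n - l n)\<^sup>2) \<le> e\<^sup>2" for N
      by (rule bound[where M = M]) (rule that)
    show s: "summable (\<lambda>n. (coord (X m) n - l n)\<^sup>2)"
    proof (rule bounded_imp_summable[where B = "e\<^sup>2"])
      show "(\<Sum>k\<le>n. (coord (X m) k - l k)\<^sup>2) \<le> e\<^sup>2" for n
        using b[of "Suc n"] by (simp only: lessThan_Suc_atMost)
    qed simp
    show "(\<Sum>n. (coord (X m) n - l n)\<^sup>2) \<le> e\<^sup>2"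
      by (rule suminf_le_const[OF s b])
  qed
  have "summable (\<lambda>n. (l n)\<^sup>2)"
  proof -
    obtain M where "\<And>k. k \<ge> M \<Longrightarrow> dist (X M) (X k) < 1"
      using X unfolding Cauchy_def by (meson order_refl zero_less_one)
    then have "summable (\<lambda>n. (- (coord (X M) n - l n))\<^sup>2)" using sq(1)[of M M 1] 
      by (simp only: power2_minus)
    then have "summable (\<lambda>n. (coord (X M) n + - (coord (X M) n - l n))\<^sup>2)"
      using coord[of "X M"] by (intro ell2_summable_add) auto
    then show ?thesis by simp
  qed
  then have L: "coord (Abs_ell2 l) = l" by (simp add: Abs_ell2_inverse)
  have "X \<longlonglongrightarrow> Abs_ell2 l"
  proof (rule metric_LIMSEQ_I)
    fix r :: real assume "0 < r"
    then obtain M where M: "\<And>m k. m \<ge> M \<Longrightarrow> k \<ge> M \<Longrightarrow> dist (X m) (X k) < r / 2"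
      using X unfolding Cauchy_def by (meson half_gt_zero)
    have "dist (X m) (Abs_ell2 l) < r" if "m \<ge> M" for m
    proof -
      have "(norm (X m - Abs_ell2 l))\<^sup>2 \<le> (r / 2)\<^sup>2"
        using sq(2)[of M m "r / 2"] M that by (simp add: ell2_norm_power2 coord_diff L)
      then have "norm (X m - Abs_ell2 l) \<le> r / 2"
        by (rule power2_le_imp_le) (use \<open>0 < r\<close> in simp)
      then show ?thesis using \<open>0 < r\<close> by (simp add: dist_norm)
    qed
    then show "\<exists>N. \<forall>m\<ge>N. dist (X m) (Abs_ell2 l) < r" by blast
  qed
  then show "convergent X" by (auto simp: convergent_def)
qed


section \<open>Uniform embeddings and compression\<close>

definition uniform_embedding ::
  "'a set \<Rightarrow> ('a \<Rightarrow> 'a \<Rightarrow> real) \<Rightarrow> ('a \<Rightarrow> 'h::{real_inner, complete_space}) \<Rightarrow> bool" where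
  "uniform_embedding X d f \<longleftrightarrow>
     (\<exists>\<rho> \<delta> :: real \<Rightarrow> real.
        \<rho> \<in> {0..} \<rightarrow> {0..} \<and> mono_on {0..} \<rho> \<and> \<delta> \<in> {0..} \<rightarrow> {0..} \<and> mono_on {0..} \<delta> \<and>
        (\<forall>x\<in>X. \<forall>y\<in>X. \<rho> (d x y) \<le> dist (f x) (f y) \<and> dist (f x) (f y) \<le> \<delta> (d x y)) \<and>
        filterlim \<rho> at_top at_top)"

text \<open>Extended reals give \<open>Inf {} = \<infinity>\<close>.\<close>

definition compression ::
  "'a set \<Rightarrow> ('a \<Rightarrow> 'a \<Rightarrow> real) \<Rightarrow> ('a \<Rightarrow> 'h::{real_inner, complete_space}) \<Rightarrow> real \<Rightarrow> ereal" where
  "compression X d f t = Inf {ereal (dist (f x) (f y)) |x y. x \<in> X \<and> y \<in> X \<and> t \<le> d x y}"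

definition asymp_le :: "(real \<Rightarrow> ereal) \<Rightarrow> (real \<Rightarrow> ereal) \<Rightarrow> bool" (infix \<open>\<preceq>\<close> 50) where
  "g \<preceq> h \<longleftrightarrow> (\<exists>C>0. \<exists>M. \<forall>t\<ge>M. g t \<le> ereal C * h t)"

end

theory Submission
  imports Defs "HOL-Real_Asymp.Real_Asymp"
begin

text \<open>
  Root the tree and give each vertex a basis vector of \<open>\<ell>\<^sup>2\<close>. A vertex is sent to the sum of
  \<open>\<xi> k\<close> times the basis vector of its \<open>k\<close>-th ancestor. Moving to a neighbour shifts the
  sequence \<open>\<xi>\<close> by one, so the map is Lipschitz once the increments of \<open>\<xi>\<close> are square
  summable. Of two vertices at distance \<open>n\<close>, one lies at distance at least \<open>n/2\<close> from the
  point where their paths to the root meet, and the ancestors below that point are not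
  ancestors of the other vertex; they contribute \<open>\<Sum>j<n/2. (\<xi> j)\<^sup>2\<close> to the squared distance.
  The increments \<open>1 / (sqrt (x ln x) ln (ln x))\<close> are square summable and make this sum of order
  \<open>n\<^sup>2 / (ln n (ln (ln n))\<^sup>2)\<close>. Continuity is not required of a uniform embedding, so points
  inside an edge may be moved to one of its ends.
\<close>

section \<open>Rooted trees\<close>

locale rooted_tree =
  fixes V :: "'v set" and E :: "'v rel" and r :: 'v
  assumes tree: "graph_tree V E" and root: "r \<in> V"
begin

lemma simple: "simple_graph V E" and connected: "connected_graph V E"
  using tree by (auto simp: graph_tree_def)

lemma edge_sym: "(u, v) \<in> E \<Longrightarrow> (v, u) \<in> E"
  using simple by (auto simp: simple_graph_def dest: symD)

lemma edge_vertices: "(u, v) \<in> E \<Longrightarrow> u \<in> V \<and> v \<in> V"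
  using simple by (auto simp: simple_graph_def)

lemma edge_neq: "(u, v) \<in> E \<Longrightarrow> u \<noteq> v"
  using simple by (auto simp: simple_graph_def irrefl_def)

lemma walk_sym: "(u, v) \<in> E ^^ n \<Longrightarrow> (v, u) \<in> E ^^ n"
proof (induction n arbitrary: v)
  case (Suc n)
  then obtain w where "(u, w) \<in> E ^^ n" "(w, v) \<in> E" by auto
  then show ?case using Suc.IH edge_sym relpow_Suc_I2 by metis
qed simp

section \<open>Depth, parents and ancestors\<close>

definition depth :: "'v \<Rightarrow> nat" where
  "depth v = (LEAST n. (r, v) \<in> E ^^ n)"

lemma depth_le: "(r, v) \<in> E ^^ n \<Longrightarrow> depth v \<le> n"
  unfolding depth_def by (rule Least_le)

lemma walk_depth:
  assumes "v \<in> V"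
  shows "(r, v) \<in> E ^^ depth v"
proof -
  obtain n where "(r, v) \<in> E ^^ n"
    using assms connected root rtrancl_imp_relpow[of "(r, v)" E]
    unfolding connected_graph_def by blast
  then show ?thesis unfolding depth_def by (rule LeastI)
qed

lemma depth_eq_0: "v \<in> V \<Longrightarrow> depth v = 0 \<longleftrightarrow> v = r"
  using walk_depth[of v] depth_le[of r 0] by auto

definition parent :: "'v \<Rightarrow> 'v" where
  "parent v = (SOME w. (v, w) \<in> E \<and> Suc (depth w) = depth v)"

text \<open>Let \<open>w\<close> precede \<open>v\<close> on a shortest walk from the root. Cutting
  off the last edge bounds \<open>depth w\<close> above, and appending it to a shortest walk to
  \<open>w\<close> bounds \<open>depth w\<close> below. At the root \<open>parent\<close> is
  arbitrary, so later statements keep the index at most the depth.\<close>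

lemma parent:
  assumes "v \<in> V" "0 < depth v"
  shows "(v, parent v) \<in> E" "Suc (depth (parent v)) = depth v"
proof -
  obtain n where n: "depth v = Suc n" using assms(2) gr0_conv_Suc by blast
  then obtain w where w: "(r, w) \<in> E ^^ n" "(w, v) \<in> E"
    using walk_depth[OF assms(1)] by auto
  have "(r, v) \<in> E ^^ Suc (depth w)"
    using walk_depth w(2) edge_vertices by auto
  then have "Suc n \<le> Suc (depth w)" using depth_le n by metis
  then have "(v, w) \<in> E \<and> Suc (depth w) = depth v"
    using depth_le[OF w(1)] n edge_sym[OF w(2)] by auto
  then have "(v, parent v) \<in> E \<and> Suc (depth (parent v)) = depth v"
    unfolding parent_def by (rule someI)
  then show "(v, parent v) \<in> E" "Suc (depth (parent v)) = depth v" by auto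
qed

abbreviation ancestor :: "nat \<Rightarrow> 'v \<Rightarrow> 'v" where
  "ancestor k \<equiv> parent ^^ k"

lemma ancestor:
  assumes "v \<in> V" "k \<le> depth v"
  shows "ancestor k v \<in> V" "depth (ancestor k v) = depth v - k" "(v, ancestor k v) \<in> E ^^ k"
proof -
  have "ancestor k v \<in> V \<and> depth (ancestor k v) = depth v - k \<and> (v, ancestor k v) \<in> E ^^ k"
    using assms(2)
  proof (induction k)
    case (Suc k)
    then have IH: "ancestor k v \<in> V" "depth (ancestor k v) = depth v - k"
      "(v, ancestor k v) \<in> E ^^ k" by auto
    have pos: "0 < depth (ancestor k v)" using IH Suc by simp
    show ?case using parent[OF IH(1) pos] IH edge_vertices by auto
  qed (use assms in auto)
  then show "ancestor k v \<in> V" "depth (ancestor k v) = depth v - k" "(v, ancestor k v) \<in> E ^^ k"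
    by auto
qed

lemma ancestor_depth: "v \<in> V \<Longrightarrow> ancestor (depth v) v = r"
  using ancestor[of v "depth v"] depth_eq_0 by simp

lemma ancestor_step:
  "v \<in> V \<Longrightarrow> Suc k \<le> depth v \<Longrightarrow> (ancestor k v, ancestor (Suc k) v) \<in> E"
  using parent(1)[of "ancestor k v"] ancestor(1,2)[of v k] by simp

lemma inj_on_ancestor:
  assumes "v \<in> V"
  shows "inj_on (\<lambda>k. ancestor k v) {..depth v}"
proof (rule inj_onI)
  fix i j assume "i \<in> {..depth v}" "j \<in> {..depth v}" "ancestor i v = ancestor j v"
  then show "i = j" using ancestor(2)[OF assms, of i] ancestor(2)[OF assms, of j] by simp
qed

text \<open>Both paths end at the root, so they share a vertex; \<open>b\<close> is chosen least for
  \<open>v\<close> alone. Equal vertices have equal depth, so a common vertex with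
  \<open>i < a\<close> would have \<open>j < b\<close>, which gives minimality on the side of
  \<open>u\<close> as well.\<close>

lemma meet:
  assumes "u \<in> V" "v \<in> V"
  obtains a b where "a \<le> depth u" "b \<le> depth v" "ancestor a u = ancestor b v"
    "\<And>i j. i \<le> depth u \<Longrightarrow> j < b \<Longrightarrow> ancestor i u \<noteq> ancestor j v"
    "\<And>i j. i < a \<Longrightarrow> j \<le> depth v \<Longrightarrow> ancestor i u \<noteq> ancestor j v"
proof -
  let ?P = "\<lambda>j. j \<le> depth v \<and> (\<exists>i\<le>depth u. ancestor i u = ancestor j v)"
  define b where "b = (LEAST j. ?P j)"
  have "?P (depth v)" using ancestor_depth assms by auto
  then have "?P b" unfolding b_def by (rule LeastI)
  then obtain a where a: "a \<le> depth u" "b \<le> depth v" "ancestor a u = ancestor b v" by blast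
  have below: "ancestor i u \<noteq> ancestor j v" if "i \<le> depth u" "j < b" for i j
    using not_less_Least[of j ?P] that a(2) unfolding b_def[symmetric] by auto
  have "ancestor i u \<noteq> ancestor j v" if "i < a" "j \<le> depth v" for i j
  proof
    assume eq: "ancestor i u = ancestor j v"
    have "depth u - i = depth v - j" "depth u - a = depth v - b"
      using ancestor(2)[OF assms(1), of i] ancestor(2)[OF assms(1), of a]
        ancestor(2)[OF assms(2), of j] ancestor(2)[OF assms(2), of b] a that eq by auto
    then have "j < b" using a that by linarith
    then show False using below[of i j] eq that a(1) by simp
  qed
  then show ?thesis using that a below by blast
qed

text \<open>Otherwise the edge would close up the two paths to the meeting point into a cycle.\<close>

lemma edge_parent:
  assumes "(u, v) \<in> E"
  shows "0 < depth v \<and> u = parent v \<or> 0 < depth u \<and> v = parent u"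
proof (rule ccontr)
  assume neg: "\<not> ?thesis"
  have uv: "u \<in> V" "v \<in> V" using assms edge_vertices by auto
  obtain a b where ab: "a \<le> depth u" "b \<le> depth v" "ancestor a u = ancestor b v"
    and below: "\<And>i j. i \<le> depth u \<Longrightarrow> j < b \<Longrightarrow> ancestor i u \<noteq> ancestor j v"
    using meet[OF uv] by metis
  \<comment> \<open>Up from \<open>u\<close> to the meeting point, then down to \<open>v\<close>;
    the second list stops before \<open>b\<close> so that the meeting point occurs once.\<close>
  define c where
    "c = map (\<lambda>i. ancestor i u) [0..<Suc a] @ rev (map (\<lambda>j. ancestor j v) [0..<b])"
  \<comment> \<open>The list \<open>c\<close> has \<open>a + b + 1\<close> entries, so the three
    pairs with \<open>a + b \<le> 1\<close> must be excluded: one would make \<open>u = v\<close>,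
    the others would make one end the parent of the other.\<close>
  have "\<not> (a = 0 \<and> b = 0)" using ab edge_neq[OF assms] by (metis funpow_0)
  moreover have "\<not> (a = 1 \<and> b = 0)"
  proof
    assume "a = 1 \<and> b = 0"
    then have "parent u = v" "0 < depth u" using ab by auto
    then show False using neg by simp
  qed
  moreover have "\<not> (a = 0 \<and> b = 1)"
  proof
    assume "a = 0 \<and> b = 1"
    then have "u = parent v" "0 < depth v" using ab by auto
    then show False using neg by simp
  qed
  ultimately have "3 \<le> length c" unfolding c_def by auto
  moreover have "distinct c"
  proof -
    have "inj_on (\<lambda>i. ancestor i u) {0..<Suc a}"
      by (rule inj_on_subset[OF inj_on_ancestor[OF uv(1)]]) (use ab in auto)
    moreover have "inj_on (\<lambda>i. ancestor i v) {0..<b}"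
      by (rule inj_on_subset[OF inj_on_ancestor[OF uv(2)]]) (use ab in auto)
    moreover have "(\<lambda>i. ancestor i u) ` {0..<Suc a} \<inter> (\<lambda>j. ancestor j v) ` {0..<b} = {}"
      using below ab(1) by fastforce
    ultimately show ?thesis
      unfolding c_def distinct_append distinct_rev distinct_map set_rev set_map set_upt by simp
  qed
  moreover have "successively (\<lambda>u v. (u, v) \<in> E) c"
  proof -
    have 1: "successively (\<lambda>u v. (u, v) \<in> E) (map (\<lambda>i. ancestor i u) [0..<Suc a])"
      unfolding successively_conv_nth
      using ancestor_step[OF uv(1)] ab(1) by (auto simp del: upt_Suc funpow.simps)
    have 2: "successively (\<lambda>v u. (u, v) \<in> E) (map (\<lambda>j. ancestor j v) [0..<b])"
      unfolding successively_conv_nth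
      using ancestor_step[OF uv(2)] ab(2) edge_sym
      by (auto simp del: upt_Suc funpow.simps)
    have 3: "(ancestor a u, ancestor (b - 1) v) \<in> E" if "b \<noteq> 0"
      using ancestor_step[OF uv(2), of "b - 1"] ab that edge_sym by auto
    have 4: "last (map (\<lambda>j. ancestor j v) [0..<b]) = ancestor (b - 1) v" if "b \<noteq> 0"
      using that by (cases b) simp_all
    show ?thesis
      unfolding c_def successively_append_iff successively_rev
      using 1 2 3 4 by (cases "b = 0") (simp_all add: hd_rev)
  qed
  moreover have "last c = v" "hd c = u"
  proof -
    show "hd c = u" unfolding c_def by (simp add: hd_append hd_map del: upt_Suc)
    show "last c = v"
    proof (cases "b = 0")
      case True
      then show ?thesis using ab unfolding c_def by simp
    next
      case False
      then show ?thesis unfolding c_def by (simp add: last_rev hd_map)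
    qed
  qed
  ultimately have "graph_cycle E c" using edge_sym[OF assms] by (simp add: graph_cycle_def)
  then show False using tree by (auto simp: graph_tree_def)
qed

text \<open>Walks of length \<open>n\<close> from the root have finitely many endpoints, by
  induction on \<open>n\<close>. Countability lets the vertices index an orthonormal family in
  \<open>ell2\<close>.\<close>

lemma countable_vertices:
  assumes "locally_finite_graph V E"
  shows "countable V"
proof -
  have "finite {v. (r, v) \<in> E ^^ n}" for n
  proof (induction n)
    case (Suc n)
    have "{v. (r, v) \<in> E ^^ Suc n} \<subseteq> (\<Union>w \<in> {w. (r, w) \<in> E ^^ n}. {v. (w, v) \<in> E})" by auto
    \<comment> \<open>Local finiteness speaks of vertices in \<open>V\<close>; outside
      \<open>V\<close> there are no edges.\<close>
    moreover have "finite {v. (w, v) \<in> E}" for w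
      using assms edge_vertices unfolding locally_finite_graph_def
      by (cases "w \<in> V") (auto simp: edge_vertices intro: finite_subset[of _ "{}"])
    ultimately show ?case using Suc by (meson finite_UN_I finite_subset)
  qed simp
  then have "countable (\<Union>n. {v. (r, v) \<in> E ^^ n})" by (simp add: countable_finite)
  moreover have "V \<subseteq> (\<Union>n. {v. (r, v) \<in> E ^^ n})" using walk_depth by auto
  ultimately show ?thesis by (rule countable_subset[rotated])
qed

section \<open>The weighted ancestor map on vertices\<close>

definition embed :: "(nat \<Rightarrow> real) \<Rightarrow> ('v \<Rightarrow> 'h::real_inner) \<Rightarrow> 'v \<Rightarrow> 'h" where
  "embed \<xi> e v = (\<Sum>k\<le>depth v. \<xi> k *\<^sub>R e (ancestor k v))"

context
  fixes e :: "'v \<Rightarrow> 'h::real_inner"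
  assumes orthonormal: "\<And>u v. u \<in> V \<Longrightarrow> v \<in> V \<Longrightarrow> inner (e u) (e v) = (if u = v then 1 else 0)"
begin

text \<open>Pythagoras along one path to the root. The coefficients are arbitrary because the lower
  bound uses \<xi> itself and the Lipschitz bound its increments.\<close>

lemma norm_sum_ancestors:
  assumes "v \<in> V" "K \<subseteq> {..depth v}"
  shows "(norm (\<Sum>k\<in>K. c k *\<^sub>R e (ancestor k v)))\<^sup>2 = (\<Sum>k\<in>K. (c k)\<^sup>2)"
proof -
  have "finite K" using assms(2) finite_subset by blast
  have "inner (c i *\<^sub>R e (ancestor i v)) (c j *\<^sub>R e (ancestor j v)) = 0"
    if "i \<in> K" "j \<in> K" "i \<noteq> j" for i j
  proof -
    have "ancestor i v \<noteq> ancestor j v"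
      using inj_onD[OF inj_on_ancestor[OF assms(1)], of i j] that assms(2) by auto
    moreover have "ancestor i v \<in> V" "ancestor j v \<in> V"
      using that assms ancestor(1) by auto
    ultimately show ?thesis using orthonormal by simp
  qed
  then have "(norm (\<Sum>k\<in>K. c k *\<^sub>R e (ancestor k v)))\<^sup>2
      = (\<Sum>k\<in>K. (norm (c k *\<^sub>R e (ancestor k v)))\<^sup>2)"
    by (intro norm_sum_Pythagorean \<open>finite K\<close>) (auto simp: pairwise_def orthogonal_def)
  also have "\<dots> = (\<Sum>k\<in>K. (c k)\<^sup>2)"
  proof (rule sum.cong)
    fix k assume "k \<in> K"
    then have "inner (e (ancestor k v)) (e (ancestor k v)) = 1"
      using assms orthonormal ancestor(1) by auto
    then show "(norm (c k *\<^sub>R e (ancestor k v)))\<^sup>2 = (c k)\<^sup>2"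
      by (simp add: norm_eq_sqrt_inner)
  qed simp
  finally show ?thesis .
qed

text \<open>The \<open>k\<close>-th ancestor of the parent is the \<open>Suc k\<close>-th ancestor
  of \<open>v\<close>. The difference of the images has coefficient \<open>\<xi> 0\<close> at
  \<open>v\<close> and an increment of \<xi> at each vertex above.\<close>

lemma embed_child:
  assumes "v \<in> V" "0 < depth v" "summable (\<lambda>k. (\<xi> (Suc k) - \<xi> k)\<^sup>2)"
  shows "dist (embed \<xi> e v) (embed \<xi> e (parent v)) \<le> \<bar>\<xi> 0\<bar> + sqrt (\<Sum>k. (\<xi> (Suc k) - \<xi> k)\<^sup>2)"
proof -
  let ?u = "parent v" and ?S = "\<Sum>k. (\<xi> (Suc k) - \<xi> k)\<^sup>2"
  have d: "depth v = Suc (depth ?u)" and u: "?u \<in> V"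
    using parent[OF assms(1,2)] edge_vertices by auto
  have "embed \<xi> e v = \<xi> 0 *\<^sub>R e v + (\<Sum>k\<le>depth ?u. \<xi> (Suc k) *\<^sub>R e (ancestor k ?u))"
    unfolding embed_def d by (simp add: sum.atMost_Suc_shift funpow_swap1 del: sum.atMost_Suc)
  then have "dist (embed \<xi> e v) (embed \<xi> e ?u)
      = norm (\<xi> 0 *\<^sub>R e v + (\<Sum>k\<le>depth ?u. (\<xi> (Suc k) - \<xi> k) *\<^sub>R e (ancestor k ?u)))"
    unfolding dist_norm embed_def by (simp add: add_diff_eq sum_subtractf scaleR_left_diff_distrib)
  moreover have "norm (\<xi> 0 *\<^sub>R e v) = \<bar>\<xi> 0\<bar>"
    using orthonormal[OF assms(1) assms(1)] by (simp add: norm_eq_sqrt_inner)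
  moreover have "norm (\<Sum>k\<le>depth ?u. (\<xi> (Suc k) - \<xi> k) *\<^sub>R e (ancestor k ?u)) \<le> sqrt ?S"
  proof (rule real_le_rsqrt)
    show "(norm (\<Sum>k\<le>depth ?u. (\<xi> (Suc k) - \<xi> k) *\<^sub>R e (ancestor k ?u)))\<^sup>2 \<le> ?S"
      unfolding norm_sum_ancestors[OF u order_refl] by (rule sum_le_suminf[OF assms(3)]) auto
  qed
  ultimately show ?thesis
    using norm_triangle_ineq[of "\<xi> 0 *\<^sub>R e v"
        "\<Sum>k\<le>depth ?u. (\<xi> (Suc k) - \<xi> k) *\<^sub>R e (ancestor k ?u)"]
    by linarith
qed

text \<open>By \<open>edge_parent\<close> every step of a walk joins a child and its parent, so the
  bound of \<open>embed_child\<close> adds up.\<close>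

lemma embed_walk:
  assumes "summable (\<lambda>k. (\<xi> (Suc k) - \<xi> k)\<^sup>2)" "(u, v) \<in> E ^^ n"
  shows "dist (embed \<xi> e u) (embed \<xi> e v) \<le> real n * (\<bar>\<xi> 0\<bar> + sqrt (\<Sum>k. (\<xi> (Suc k) - \<xi> k)\<^sup>2))"
    (is "_ \<le> _ * ?L")
  using assms(2)
proof (induction n arbitrary: v)
  case (Suc n)
  then obtain w where w: "(u, w) \<in> E ^^ n" "(w, v) \<in> E" by auto
  have wv: "w \<in> V" "v \<in> V" using edge_vertices w(2) by auto
  have step: "dist (embed \<xi> e w) (embed \<xi> e v) \<le> ?L"
    using edge_parent[OF w(2)]
  proof
    assume "0 < depth v \<and> w = parent v"
    then show ?thesis using embed_child[OF wv(2) _ assms(1)] by (simp add: dist_commute)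
  next
    assume "0 < depth w \<and> v = parent w"
    then show ?thesis using embed_child[OF wv(1) _ assms(1)] by simp
  qed
  have "dist (embed \<xi> e u) (embed \<xi> e v) \<le> real n * ?L + ?L"
    using dist_triangle[of "embed \<xi> e u" "embed \<xi> e v" "embed \<xi> e w"] Suc.IH[OF w(1)] step
    by linarith
  also have "\<dots> = real (Suc n) * ?L" by (simp only: of_nat_Suc distrib_right mult_1 add.commute)
  finally show ?case .
qed simp

text \<open>The part \<open>A\<close> of the image of \<open>v\<close> carried by its first
  \<open>b\<close> ancestors is orthogonal both to the rest \<open>B\<close> and to the image of
  \<open>u\<close>, so the distance is at least \<open>norm A\<close>.\<close>

lemma embed_lower_ancestors:
  assumes "u \<in> V" "v \<in> V" "b \<le> Suc (depth v)"
    "\<And>i j. i \<le> depth u \<Longrightarrow> j < b \<Longrightarrow> ancestor i u \<noteq> ancestor j v"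
  shows "(\<Sum>j<b. (\<xi> j)\<^sup>2) \<le> (dist (embed \<xi> e u) (embed \<xi> e v))\<^sup>2"
proof -
  define A where "A = (\<Sum>j<b. \<xi> j *\<^sub>R e (ancestor j v))"
  define B where "B = (\<Sum>j\<in>{b..depth v}. \<xi> j *\<^sub>R e (ancestor j v))"
  have eq: "embed \<xi> e v = A + B"
  proof -
    have "{..depth v} = {..<b} \<union> {b..depth v}" using assms(3) by auto
    moreover have "{..<b} \<inter> {b..depth v} = {}" by auto
    ultimately show ?thesis unfolding A_def B_def embed_def
      using sum.union_disjoint[of "{..<b}" "{b..depth v}"] by simp
  qed
  have "inner A B = 0"
    unfolding A_def B_def inner_sum_left inner_sum_right
  proof (intro sum.neutral ballI)
    fix i j assume ij: "i \<in> {..<b}" "j \<in> {b..depth v}"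
    then have "ancestor i v \<noteq> ancestor j v"
      using inj_onD[OF inj_on_ancestor[OF assms(2)], of i j] by auto
    then show "inner (\<xi> i *\<^sub>R e (ancestor i v)) (\<xi> j *\<^sub>R e (ancestor j v)) = 0"
      using ij orthonormal ancestor(1)[OF assms(2)] by auto
  qed
  moreover have "inner A (embed \<xi> e u) = 0"
    unfolding A_def embed_def inner_sum_left inner_sum_right
  proof (intro sum.neutral ballI)
    fix i j assume ij: "i \<in> {..<b}" "j \<in> {..depth u}"
    then have "ancestor i v \<noteq> ancestor j u" using assms(4)[of j i] by auto
    then show "inner (\<xi> i *\<^sub>R e (ancestor i v)) (\<xi> j *\<^sub>R e (ancestor j u)) = 0"
      using ij assms(3) orthonormal ancestor(1)[OF assms(2)] ancestor(1)[OF assms(1)] by auto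
  qed
  ultimately have "orthogonal A (B - embed \<xi> e u)"
    by (simp add: orthogonal_def inner_diff_right)
  then have "(norm (A + (B - embed \<xi> e u)))\<^sup>2 = (norm A)\<^sup>2 + (norm (B - embed \<xi> e u))\<^sup>2"
    by (rule norm_add_Pythagorean)
  moreover have "(norm A)\<^sup>2 = (\<Sum>j<b. (\<xi> j)\<^sup>2)"
    unfolding A_def by (rule norm_sum_ancestors[OF assms(2)]) (use assms(3) in auto)
  moreover have "dist (embed \<xi> e u) (embed \<xi> e v) = norm (A + (B - embed \<xi> e u))"
    by (subst dist_commute) (simp add: dist_norm eq add_diff_eq)
  ultimately show ?thesis by simp
qed

lemma embed_lower:
  assumes "u \<in> V" "v \<in> V"
    "2 * real m \<le> geodesic_dist V E (vertex_point u) (vertex_point v)"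
  shows "(\<Sum>j<m. (\<xi> j)\<^sup>2) \<le> (dist (embed \<xi> e u) (embed \<xi> e v))\<^sup>2"
proof -
  obtain a b where ab: "a \<le> depth u" "b \<le> depth v" "ancestor a u = ancestor b v"
    and below: "\<And>i j. i \<le> depth u \<Longrightarrow> j < b \<Longrightarrow> ancestor i u \<noteq> ancestor j v"
      "\<And>i j. i < a \<Longrightarrow> j \<le> depth v \<Longrightarrow> ancestor i u \<noteq> ancestor j v"
    by (rule meet[OF assms(1,2)]) (rule that; assumption)
  have "(u, ancestor b v) \<in> E ^^ a" "(ancestor b v, v) \<in> E ^^ b"
    using ancestor(3)[OF assms(1) ab(1)] walk_sym[OF ancestor(3)[OF assms(2) ab(2)]] ab(3) by auto
  then have "(u, v) \<in> E ^^ (a + b)" unfolding relpow_add by blast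
  from chain_of_walk[OF simple assms(1) this]
  have "geodesic_dist V E (vertex_point u) (vertex_point v) \<le> real (a + b)"
    using geodesic_dist_le by metis
  \<comment> \<open>The walk through the meeting point gives \<open>2 * m \<le> a + b\<close>, so
    one leg has at least \<open>m\<close> edges.\<close>
  then consider "m \<le> a" | "m \<le> b" using assms(3) by linarith
  then show ?thesis
  proof cases
    case 1
    have "(\<Sum>j<m. (\<xi> j)\<^sup>2) \<le> (dist (embed \<xi> e v) (embed \<xi> e u))\<^sup>2"
    proof (rule embed_lower_ancestors[OF assms(2,1)])
      show "ancestor i v \<noteq> ancestor j u" if "i \<le> depth v" "j < m" for i j
        using below(2)[of j i] that 1 by auto
    qed (use 1 ab in simp)
    then show ?thesis by (simp add: dist_commute)
  next
    case 2
    show ?thesis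
      by (rule embed_lower_ancestors[OF assms(1,2)]) (use 2 ab below in auto)
  qed
qed

end

end

section \<open>The weights\<close>

text \<open>The square is the term of a barely convergent Bertrand series. Arguments stay at least
  4, beyond e, so that both logarithms are positive.\<close>

definition bertrand :: "real \<Rightarrow> real" where
  "bertrand x = 1 / (sqrt x * sqrt (ln x) * ln (ln x))"

lemma ln_gt_1: "1 < ln x" if "4 \<le> x" for x :: real
proof -
  have "exp 1 < x" using exp_le that by linarith
  then show ?thesis using that by (metis exp_less_cancel_iff exp_ln exp_gt_zero order.strict_trans)
qed

lemma ln_ln_pos: "0 < ln (ln x)" if "4 \<le> x" for x :: real
  using ln_gt_1[OF that] by simp

lemma ln_ln_mono: "ln (ln x) \<le> ln (ln y)" if "4 \<le> x" "x \<le> y" for x y :: real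
  using ln_gt_1[of x] ln_gt_1[of y] that by simp

lemma bertrand_pos: "4 \<le> x \<Longrightarrow> 0 < bertrand x"
  using ln_gt_1[of x] ln_ln_pos[of x] by (simp add: bertrand_def)

lemma bertrand_power2: "4 \<le> x \<Longrightarrow> (bertrand x)\<^sup>2 = 1 / (x * ln x * (ln (ln x))\<^sup>2)"
  using ln_gt_1[of x] by (simp add: bertrand_def power_divide power_mult_distrib)

lemma bertrand_antimono:
  assumes "4 \<le> x" "x \<le> y"
  shows "bertrand y \<le> bertrand x"
  unfolding bertrand_def
  using assms ln_gt_1[of x] ln_gt_1[of y] ln_ln_pos[of x] ln_ln_pos[of y] ln_ln_mono[of x y]
  by (intro divide_left_mono mult_mono mult_pos_pos) auto

text \<open>The function \<open>1 / (x ln x (ln (ln x))\<^sup>2)\<close> is minus the derivative of \<open>1 / ln (ln x)\<close>.\<close>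

lemma bertrand_telescope:
  fixes x :: real
  assumes "4 \<le> x"
  shows "(bertrand (x + 1))\<^sup>2 \<le> 1 / ln (ln x) - 1 / ln (ln (x + 1))"
proof -
  let ?y = "x + 1"
  define p q where "p = ln (ln x)" and "q = ln (ln ?y)"
  have l: "1 < ln x" "1 < ln ?y" using ln_gt_1[of x] ln_gt_1[of ?y] assms by auto
  have pq: "0 < p" "p \<le> q"
    using ln_ln_pos[of x] ln_ln_mono[of x ?y] assms by (auto simp: p_def q_def)
  \<comment> \<open>This form of \<open>ln c \<le> c - 1\<close> replaces the derivative; it serves
    once for each of the two logarithms.\<close>
  have tangent: "1 - a / b \<le> ln b - ln a" if "0 < a" "0 < b" for a b :: real
    using ln_le_minus_one[of "a / b"] that by (simp add: ln_div)
  have "1 / (?y * ln ?y) = (1 - x / ?y) / ln ?y"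
    using assms by (simp add: field_simps)
  also have "\<dots> \<le> (ln ?y - ln x) / ln ?y"
    using tangent[of x ?y] l assms by (intro divide_right_mono) auto
  also have "\<dots> = 1 - ln x / ln ?y" using l by (simp add: diff_divide_distrib)
  also have "\<dots> \<le> q - p" unfolding p_def q_def using tangent[of "ln x" "ln ?y"] l by simp
  finally have qp: "1 / (?y * ln ?y) \<le> q - p" .
  have "(bertrand ?y)\<^sup>2 = 1 / (?y * ln ?y) / q\<^sup>2"
    using assms by (simp add: bertrand_power2 q_def)
  also have "\<dots> \<le> (q - p) / q\<^sup>2" by (intro divide_right_mono qp) simp
  \<comment> \<open>Lowering one factor \<open>q\<close> to \<open>p\<close> turns the fraction into
    a difference of reciprocals.\<close>
  also have "\<dots> \<le> (q - p) / (p * q)"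
    using pq by (intro divide_left_mono) (auto simp: power2_eq_square)
  also have "\<dots> = 1 / p - 1 / q" using pq by (simp add: field_simps)
  finally show ?thesis by (simp add: p_def q_def)
qed

text \<open>The telescope starts at 4 and bounds the term one further on, hence the offset
  5.\<close>

lemma bertrand_summable: "summable (\<lambda>k. (bertrand (real k + 5))\<^sup>2)"
proof (rule summableI_nonneg_bounded)
  fix n
  have "(\<Sum>k<n. (bertrand (real k + 5))\<^sup>2) \<le> 1 / ln (ln 4) - 1 / ln (ln (real n + 4))"
  proof (induction n)
    case (Suc n)
    then show ?case using bertrand_telescope[of "real n + 4"] by (simp add: add.commute)
  qed simp
  also have "\<dots> \<le> 1 / ln (ln 4)" using ln_ln_pos[of "real n + 4"] by simp
  finally show "(\<Sum>k<n. (bertrand (real k + 5))\<^sup>2) \<le> 1 / ln (ln 4)" .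
qed simp

section \<open>Growth of the accumulated weights\<close>

definition profile :: "nat \<Rightarrow> real" where
  "profile k = (\<Sum>i\<le>k. bertrand (real i + 5))"

lemma profile_diff_summable: "summable (\<lambda>k. (profile (Suc k) - profile k)\<^sup>2)"
  using bertrand_summable summable_Suc_iff[of "\<lambda>k. (bertrand (real k + 5))\<^sup>2"]
  by (simp add: profile_def)

text \<open>Comparing all summands with the value at \<open>m\<close> instead of \<open>j\<close>
  gives a factor common to all \<open>j \<le> m\<close>, which leaves a sum of squares in
  \<open>growth_power2_ge\<close>.\<close>

lemma profile_ge:
  assumes "j \<le> m"
  shows "(real j + 1) * bertrand (real m + 5) \<le> profile j"
proof -
  have "(\<Sum>i\<le>j. bertrand (real m + 5)) \<le> profile j"
    unfolding profile_def using assms by (intro sum_mono bertrand_antimono) auto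
  then show ?thesis by (simp add: add.commute)
qed

lemma sum_squares_ge: "real m ^ 3 / 3 \<le> (\<Sum>j<m. (real j + 1)\<^sup>2)"
  by (induction m) (auto simp: power2_eq_square power3_eq_cube field_simps)

definition growth :: "nat \<Rightarrow> real" where
  "growth m = sqrt (\<Sum>j<m. (profile j)\<^sup>2)"

lemma growth_mono: "m \<le> n \<Longrightarrow> growth m \<le> growth n"
  unfolding growth_def by (intro real_sqrt_le_mono sum_mono2) auto

lemma growth_power2_ge: "real m ^ 3 / 3 * (bertrand (real m + 5))\<^sup>2 \<le> (growth m)\<^sup>2"
proof -
  have "real m ^ 3 / 3 * (bertrand (real m + 5))\<^sup>2
      \<le> (\<Sum>j<m. (real j + 1)\<^sup>2) * (bertrand (real m + 5))\<^sup>2"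
    by (intro mult_right_mono sum_squares_ge) simp
  also have "\<dots> = (\<Sum>j<m. ((real j + 1) * bertrand (real m + 5))\<^sup>2)"
    by (simp add: sum_distrib_right power_mult_distrib)
  also have "\<dots> \<le> (\<Sum>j<m. (profile j)\<^sup>2)"
    using bertrand_pos[of "real m + 5"]
    by (intro sum_mono power_mono profile_ge) auto
  also have "\<dots> = (growth m)\<^sup>2" unfolding growth_def by (simp add: sum_nonneg)
  finally show ?thesis .
qed

text \<open>In the index, 2 is lost by moving both points to vertices, and the halving comes from
  keeping one of the two legs below the meeting point.\<close>

lemma growth_ge:
  fixes t :: real
  assumes "8 \<le> t"
  shows "t / (sqrt (ln t) * ln (ln t)) / 14 \<le> growth (nat \<lfloor>(t - 2) / 2\<rfloor>)"
proof (rule power2_le_imp_le)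
  define m where "m = nat \<lfloor>(t - 2) / 2\<rfloor>"
  have "real m \<le> (t - 2) / 2" "(t - 2) / 2 < real m + 1"
    using assms floor_correct[of "(t - 2) / 2"] unfolding m_def by simp_all
  \<comment> \<open>Both use \<open>8 \<le> t\<close>: \<open>m > t / 2 - 2 \<ge> t / 4\<close> and
    \<open>m + 5 \<le> t / 2 + 4 \<le> t\<close>.\<close>
  then have m: "t / 4 \<le> real m" "real m + 5 \<le> t" using assms by auto
  have l: "1 < ln t" "0 < ln (ln t)" using ln_gt_1[of t] ln_ln_pos[of t] assms by auto
  have "(t / (sqrt (ln t) * ln (ln t)) / 14)\<^sup>2 = t\<^sup>2 / (ln t * (ln (ln t))\<^sup>2) / 196"
    using l by (simp add: power_divide power_mult_distrib)
  \<comment> \<open>The cube of \<open>t / 4\<close> and the factor 1/3 cost 64 * 3 = 192, rounded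
    up to 196, the square of 14.\<close>
  also have "\<dots> \<le> t\<^sup>2 / (ln t * (ln (ln t))\<^sup>2) / 192"
    using l by (intro divide_left_mono) auto
  also have "\<dots> = (t / 4) ^ 3 / 3 * (1 / (t * ln t * (ln (ln t))\<^sup>2))"
    using assms by (simp add: power2_eq_square power3_eq_cube)
  also have "\<dots> = (t / 4) ^ 3 / 3 * (bertrand t)\<^sup>2"
    using assms by (simp add: bertrand_power2)
  also have "\<dots> \<le> real m ^ 3 / 3 * (bertrand (real m + 5))\<^sup>2"
    using m assms bertrand_pos[of t]
    by (intro mult_mono divide_right_mono power_mono bertrand_antimono) auto
  also have "\<dots> \<le> (growth m)\<^sup>2" by (rule growth_power2_ge)
  finally show "(t / (sqrt (ln t) * ln (ln t)) / 14)\<^sup>2 \<le> (growth (nat \<lfloor>(t - 2) / 2\<rfloor>))\<^sup>2"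
    by (simp add: m_def)
qed (simp add: growth_def sum_nonneg)

lemma growth_at_top: "filterlim (\<lambda>t. growth (nat \<lfloor>(t - 2) / 2\<rfloor>)) at_top (at_top :: real filter)"
proof (rule filterlim_at_top_mono)
  show "filterlim (\<lambda>t::real. t / (sqrt (ln t) * ln (ln t)) / 14) at_top at_top" by real_asymp
  show "\<forall>\<^sub>F t in at_top. t / (sqrt (ln t) * ln (ln t)) / 14 \<le> growth (nat \<lfloor>(t - 2) / 2\<rfloor>)"
    using growth_ge by (auto intro: eventually_at_top_linorderI)
qed

section \<open>The embedding\<close>

lift_definition unit_ell2 :: "nat \<Rightarrow> ell2" is "\<lambda>k n. if n = k then 1 else 0"
  by (rule summable_finite[of "{_}"]) auto

lemma inner_unit_ell2: "inner (unit_ell2 i) (unit_ell2 j) = (if i = j then 1 else 0)"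
proof transfer
  fix i j :: nat
  have "(\<lambda>n. (if n = i then 1 else 0) * (if n = j then 1 else 0 :: real))
      = (\<lambda>n. if n = i then if i = j then 1 else 0 else 0)" by auto
  then show "(\<Sum>n. (if n = i then 1 else 0) * (if n = j then 1 else 0 :: real))
      = (if i = j then 1 else 0)"
    using sums_unique[OF sums_single[of i "\<lambda>_. if i = j then 1 else 0 :: real"]] by simp
qed

section \<open>Moving points of edges to vertices\<close>

definition near :: "('v \<Rightarrow> real) \<Rightarrow> 'v" where
  "near x = (SOME u. u \<in> supp x)"

lemma near:
  assumes "simple_graph V E" "x \<in> realization V E"
  shows "near x \<in> V" "geodesic_dist V E x (vertex_point (near x)) \<le> 1"
proof -
  let ?p = "vertex_point (near x)"
  have s: "supp x \<in> simplices V E" "\<And>v. 0 \<le> x v" "sum x (supp x) = 1"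
    using assms(2) by (auto simp: realization_def)
  have "\<exists>u. u \<in> supp x" using s(1) by (auto simp: simplices_def)
  then have u: "near x \<in> supp x" unfolding near_def by (rule someI_ex)
  then show V: "near x \<in> V"
    using s(1) assms(1) by (auto simp: simplices_def simple_graph_def)
  have fin: "finite (supp x)" using s(1) by (rule finite_simplex)
  have "edge_dist x ?p = (\<Sum>v\<in>supp x. \<bar>x v - ?p v\<bar>) / 2"
    by (rule edge_dist_superset[OF fin]) (use u in auto)
  \<comment> \<open>Both functions have total mass 1, so this crude bound already gives 1.\<close>
  also have "\<dots> \<le> (\<Sum>v\<in>supp x. x v + ?p v) / 2"
    using s(2) by (intro divide_right_mono sum_mono) (auto simp: vertex_point_def abs_le_iff)
  also have "\<dots> = 1"
    using u fin s(3) by (simp add: sum.distrib vertex_point_def)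
  finally have "edge_dist x ?p \<le> 1" .
  moreover have "[x, ?p] \<in> chains V E x ?p"
    using assms(2) s(1) u V by (auto simp: chains_def vertex_point_in_realization)
  ultimately show "geodesic_dist V E x ?p \<le> 1"
    using geodesic_dist_le[of "[x, ?p]"] by fastforce
qed

lemma geodesic_dist_near:
  assumes "simple_graph V E" "connected_graph V E" "x \<in> realization V E" "y \<in> realization V E"
  shows "\<bar>geodesic_dist V E x y - geodesic_dist V E (vertex_point (near x)) (vertex_point (near y))\<bar>
      \<le> 2"
proof -
  interpret Metric_space "realization V E" "geodesic_dist V E"
    by (rule Metric_space_realization[OF assms(1,2)])
  let ?p = "vertex_point (near x)" and ?q = "vertex_point (near y)"
  have p: "?p \<in> realization V E" "?q \<in> realization V E"
    using near(1) assms vertex_point_in_realization by metis+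
  show ?thesis
    using triangle[OF assms(3) p(1) assms(4)] triangle[OF p(1) p(2) assms(4)]
      triangle[OF p(1) assms(3) p(2)] triangle[OF assms(3,4) p(2)]
      near(2)[OF assms(1,3)] near(2)[OF assms(1,4)] commute[of x ?p] commute[of y ?q]
    by linarith
qed

theorem theorem2p6:
  fixes V :: "'v set" and E :: "'v rel"
  assumes "graph_tree V E" and "locally_finite_graph V E"
  shows "\<exists>f :: ('v \<Rightarrow> real) \<Rightarrow> ell2.
           uniform_embedding (realization V E) (geodesic_dist V E) f \<and>
           (\<lambda>t. ereal (t / (sqrt (ln t) * ln (ln t))))
             \<preceq> compression (realization V E) (geodesic_dist V E) f"
proof -
  obtain r where "r \<in> V"
    using assms(1) by (auto simp: graph_tree_def connected_graph_def)
  then interpret rooted_tree V E r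
    by unfold_locales (rule assms(1))
  let ?X = "realization V E" and ?d = "geodesic_dist V E"
  \<comment> \<open>\<open>to_nat_on V\<close> is injective on the countable set \<open>V\<close>,
    so orthonormality is claimed there.\<close>
  define e where "e v = unit_ell2 (to_nat_on V v)" for v
  have orthonormal: "inner (e u) (e v) = (if u = v then 1 else 0)" if "u \<in> V" "v \<in> V" for u v
    using that inj_on_to_nat_on[OF countable_vertices[OF assms(2)]]
    by (simp add: e_def inner_unit_ell2 inj_on_eq_iff)
  define f where "f x = embed profile e (near x)" for x
  \<comment> \<open>\<open>nat\<close> sends a negative floor to 0, so \<rho> vanishes below 2 and
    such distances need no estimate.\<close>
  define \<rho> where "\<rho> t = growth (nat \<lfloor>(t - 2) / 2\<rfloor>)" for t :: real
  define L where "L = \<bar>profile 0\<bar> + sqrt (\<Sum>k. (profile (Suc k) - profile k)\<^sup>2)"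
  have "0 \<le> L" unfolding L_def by (simp add: suminf_nonneg profile_diff_summable)
  have \<rho>_mono: "\<rho> s \<le> \<rho> t" if "s \<le> t" for s t
    unfolding \<rho>_def using that by (intro growth_mono nat_mono floor_mono) simp
  have lower: "\<rho> (?d x y) \<le> dist (f x) (f y)" if "x \<in> ?X" "y \<in> ?X" for x y
  proof (cases "?d x y < 2")
    case True
    then have "nat \<lfloor>(?d x y - 2) / 2\<rfloor> = 0" by simp
    then show ?thesis unfolding \<rho>_def by (simp add: growth_def)
  next
    case False
    define m where "m = nat \<lfloor>(?d x y - 2) / 2\<rfloor>"
    have "real m \<le> (?d x y - 2) / 2" unfolding m_def using False by (intro of_nat_floor) simp
    then have "2 * real m \<le> ?d (vertex_point (near x)) (vertex_point (near y))"
      using abs_le_D1[OF geodesic_dist_near[OF simple connected that]] by (simp add: field_simps)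
    from embed_lower[OF orthonormal near(1)[OF simple that(1)] near(1)[OF simple that(2)] this,
        of profile]
    show ?thesis unfolding \<rho>_def m_def[symmetric] growth_def f_def by (intro real_le_lsqrt) auto
  qed
  \<comment> \<open>The summand 2 pays for the move to vertices: points of one edge may go to
    different ends however close they are.\<close>
  have upper: "dist (f x) (f y) \<le> (?d x y + 2) * L" if "x \<in> ?X" "y \<in> ?X" for x y
  proof -
    let ?u = "near x" and ?v = "near y"
    have uv: "?u \<in> V" "?v \<in> V" using near(1)[OF simple] that by auto
    define n where "n = (LEAST n. (?u, ?v) \<in> E ^^ n)"
    have "\<exists>n. (?u, ?v) \<in> E ^^ n"
      using connected uv rtrancl_imp_relpow[of "(?u, ?v)" E]
      unfolding connected_graph_def by blast
    then have "(?u, ?v) \<in> E ^^ n" unfolding n_def by (rule LeastI_ex)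
    from embed_walk[OF orthonormal profile_diff_summable this]
    have "dist (f x) (f y) \<le> real n * L" by (simp add: f_def L_def)
    also have "\<dots> \<le> (?d x y + 2) * L"
      using geodesic_dist_near[OF simple connected that]
        geodesic_dist_vertex_point[OF simple connected uv]
      by (intro mult_right_mono \<open>0 \<le> L\<close>) (simp add: n_def)
    finally show ?thesis .
  qed
  have "uniform_embedding ?X ?d f"
    unfolding uniform_embedding_def
  proof (intro exI conjI ballI)
    show "\<rho> \<in> {0..} \<rightarrow> {0..}" by (auto simp: \<rho>_def growth_def sum_nonneg)
    show "mono_on {0..} \<rho>" by (auto intro: mono_onI \<rho>_mono)
    show "(\<lambda>t. (t + 2) * L) \<in> {0..} \<rightarrow> {0..}" using \<open>0 \<le> L\<close> by auto
    show "mono_on {0..} (\<lambda>t. (t + 2) * L)" using \<open>0 \<le> L\<close> by (auto intro!: mono_onI mult_right_mono)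
    show "filterlim \<rho> at_top at_top" unfolding \<rho>_def by (rule growth_at_top)
  qed (auto intro: lower upper)
  moreover have "(\<lambda>t. ereal (t / (sqrt (ln t) * ln (ln t)))) \<preceq> compression ?X ?d f"
    unfolding asymp_le_def
  \<comment> \<open>The constants 14 and 8 are those of \<open>growth_ge\<close>.\<close>
  proof (rule exI[of _ 14], rule conjI, simp, rule exI[of _ 8], intro allI impI)
    fix t :: real assume "8 \<le> t"
    let ?g = "t / (sqrt (ln t) * ln (ln t))"
    have "ereal (?g / 14) \<le> compression ?X ?d f t"
      unfolding compression_def
    \<comment> \<open>This also covers a bounded tree, where for large \<open>t\<close> the set is
      empty and its infimum infinite.\<close>
    proof (rule Inf_greatest)
      fix z assume "z \<in> {ereal (dist (f x) (f y)) |x y. x \<in> ?X \<and> y \<in> ?X \<and> t \<le> ?d x y}"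
      then obtain x y where xy: "z = ereal (dist (f x) (f y))" "x \<in> ?X" "y \<in> ?X" "t \<le> ?d x y"
        by blast
      have "?g / 14 \<le> \<rho> t" unfolding \<rho>_def by (rule growth_ge[OF \<open>8 \<le> t\<close>])
      also have "\<dots> \<le> \<rho> (?d x y)" by (rule \<rho>_mono[OF xy(4)])
      also have "\<dots> \<le> dist (f x) (f y)" by (rule lower[OF xy(2,3)])
      finally show "ereal (?g / 14) \<le> z" using xy(1) by simp
    qed
    then have "ereal 14 * ereal (?g / 14) \<le> ereal 14 * compression ?X ?d f t"
      by (rule ereal_mult_left_mono) simp
    then show "ereal ?g \<le> ereal 14 * compression ?X ?d f t" by simp
  qed
  ultimately show ?thesis by blast
qed

end
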